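(* Let $f:\mathcal{S}^n\to\mathbb{R}$ be convex and continuous, let $A_1,\dots,A_m\in\mathcal{S}^n$, let $\mathcal{A}:\mathcal{S}^n\to\mathbb{R}^m$ be given by $\mathcal{A}(X)_i=\langle X,A_i\rangle$, let $x_0\in\mathbb{R}^n$, $X_0=x_0x_0^t$, and let $b=\mathcal{A}(X_0)$. If $X_0$ minimizes $$\min f(X)\ \text{ subject to }\ X\succeq 0,\ \mathcal{A}(X)=b,$$ and the vectors $A_1x_0,\dots,A_mx_0$ are linearly independent, then there exists a dual certificate at $X_0$.
   Context: $\mathcal{S}^n$ is the space of real symmetric $n\times n$ matrices with inner product $\langle X,Y\rangle=\operatorname{tr}(Y^tX)$; $\perp$ denotes orthogonality for this inner product. $X\succeq 0$ (resp. $X\preceq 0$) means $X$ is positive (resp. negative) semidefinite. The adjoint of $\mathcal{A}$ is $\mathcal{A}^*\lambda=\sum_{i=1}^m\lambda_iA_i$. $\partial f$ denotes the convex subdifferential with respect to $\langle\cdot,\cdot\rangle$ on $\mathcal{S}^n$. A dual certificate at $X_0$ is a pair $(\lambda,Q)\in\mathbb{R}^m\times\mathcal{S}^n$ such that $\mathcal{A}^*\lambda+Q\in-\partial f(X_0)$, $Q\preceq 0$, and $Q\perp X_0$. *)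

theory Defs
  imports "HOL-Analysis.Analysis"
begin

definition sym_matrices :: "(real^'n^'n) set" where
  "sym_matrices = {X. transpose X = X}"

text \<open>The inner product on square matrices inherited from the library's iterated vector type is
  the trace inner product.\<close>

lemma inner_matrix_eq_trace:
  fixes X Y :: "real^'n^'n"
  shows "X \<bullet> Y = trace (transpose Y ** X)"
proof -
  have "X \<bullet> Y = (\<Sum>i\<in>UNIV. \<Sum>j\<in>UNIV. X $ i $ j * Y $ i $ j)"
    by (simp add: inner_vec_def)
  also have "\<dots> = (\<Sum>j\<in>UNIV. \<Sum>i\<in>UNIV. X $ i $ j * Y $ i $ j)"
    by (rule sum.swap)
  also have "\<dots> = trace (transpose Y ** X)"
    by (simp add: trace_def matrix_matrix_mult_def transpose_def mult.commute)
  finally show ?thesis .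
qed

definition pos_semidef :: "real^'n^'n \<Rightarrow> bool" where
  "pos_semidef X \<longleftrightarrow> X \<in> sym_matrices \<and> (\<forall>v. 0 \<le> v \<bullet> (X *v v))"

definition neg_semidef :: "real^'n^'n \<Rightarrow> bool" where
  "neg_semidef X \<longleftrightarrow> X \<in> sym_matrices \<and> (\<forall>v. v \<bullet> (X *v v) \<le> 0)"

definition outer_square :: "real^'n \<Rightarrow> real^'n^'n" where
  "outer_square x = (columnvector x :: real^1^'n) ** (rowvector x :: real^'n^1)"

definition meas :: "('m::finite \<Rightarrow> real^'n^'n) \<Rightarrow> real^'n^'n \<Rightarrow> real^'m" where
  "meas A X = (\<chi> i. X \<bullet> A i)"

definition meas_adjoint :: "('m::finite \<Rightarrow> real^'n^'n) \<Rightarrow> real^'m \<Rightarrow> real^'n^'n" where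
  "meas_adjoint A l = (\<Sum>i\<in>UNIV. (l $ i) *\<^sub>R A i)"

text \<open>A function on the space of symmetric matrices is represented by a function on all square
  matrices, of which only the values on \<^const>\<open>sym_matrices\<close> are used. Accordingly, both the
  subgradients and the points at which the subgradient inequality is tested are symmetric.\<close>

definition subdifferential :: "(real^'n^'n \<Rightarrow> real) \<Rightarrow> real^'n^'n \<Rightarrow> (real^'n^'n) set" where
  "subdifferential f X =
     {V \<in> sym_matrices. \<forall>Y \<in> sym_matrices. f X + V \<bullet> (Y - X) \<le> f Y}"

definition dual_certificate ::
  "(real^'n^'n \<Rightarrow> real) \<Rightarrow> ('m::finite \<Rightarrow> real^'n^'n) \<Rightarrow> real^'n^'n
     \<Rightarrow> real^'m \<Rightarrow> real^'n^'n \<Rightarrow> bool" where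
  "dual_certificate f A X0 l Q \<longleftrightarrow>
     Q \<in> sym_matrices \<and>
     meas_adjoint A l + Q \<in> uminus ` subdifferential f X0 \<and>
     neg_semidef Q \<and> orthogonal Q X0"

text \<open>Linear independence of an indexed family: repeated vectors count as dependent, so
  independence of the range alone would be too weak.\<close>

definition independent_family :: "('m \<Rightarrow> 'a::real_vector) \<Rightarrow> bool" where
  "independent_family v \<longleftrightarrow> inj v \<and> independent (range v)"

end

theory Submission
  imports Defs
begin

text \<open>The point \<open>0\<close> lies outside the convex set of triples \<open>(\<A>(Y) - b, Y - P, t)\<close> with \<open>Y\<close> symmetric,
  \<open>P\<close> positive semidefinite and \<open>t > f(Y) - f(X\<^sub>0)\<close>. A separating functional \<open>(\<lambda>, Q, s)\<close> has
  \<open>Q \<preceq> 0\<close>, \<open>Q \<perp> X\<^sub>0\<close> and \<open>s \<ge> 0\<close>; if \<open>s > 0\<close>, then \<open>(\<lambda>, Q) / s\<close> is a dual certificate.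
  If \<open>s = 0\<close>, then \<open>\<A>\<^sup>*\<lambda> + Q = 0\<close>; as \<open>Q \<preceq> 0\<close> and \<open>Q \<perp> x\<^sub>0x\<^sub>0\<^sup>t\<close> force \<open>Qx\<^sub>0 = 0\<close>, the independence of
  the \<open>A\<^sub>ix\<^sub>0\<close> gives \<open>\<lambda> = 0\<close> and then \<open>Q = 0\<close>, a contradiction.\<close>

lemma subspace_sym_matrices: "subspace (sym_matrices :: (real^'n^'n) set)"
  by (auto simp: subspace_def sym_matrices_def transpose_def vec_eq_iff)

lemma outer_square_nth: "outer_square x $ i $ j = x $ i * x $ j"
  by (simp add: outer_square_def matrix_matrix_mult_def columnvector_def rowvector_def)

lemma inner_outer_square: "W \<bullet> outer_square v = v \<bullet> (W *v v)"
  by (simp add: inner_vec_def outer_square_nth matrix_vector_mult_def sum_distrib_left mult_ac)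

lemma pos_semidef_outer_square: "pos_semidef (outer_square x)"
proof -
  have "v \<bullet> (outer_square x *v v) = (x \<bullet> v)\<^sup>2" for v
    by (simp add: inner_vec_def outer_square_nth matrix_vector_mult_def sum_distrib_left
        sum_product power2_eq_square mult_ac)
  then show ?thesis
    by (simp add: pos_semidef_def sym_matrices_def transpose_def vec_eq_iff outer_square_nth
        mult.commute)
qed

lemma pos_semidef_add: "pos_semidef P \<Longrightarrow> pos_semidef R \<Longrightarrow> pos_semidef (P + R)"
  by (simp add: pos_semidef_def subspace_add[OF subspace_sym_matrices]
      matrix_vector_mult_add_rdistrib inner_add_right)

lemma pos_semidef_scaleR: "0 \<le> c \<Longrightarrow> pos_semidef P \<Longrightarrow> pos_semidef (c *\<^sub>R P)"
  by (simp add: pos_semidef_def subspace_scale[OF subspace_sym_matrices]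
      scaleR_matrix_vector_assoc[symmetric])

lemma pos_semidef_zero: "pos_semidef 0"
  by (simp add: pos_semidef_def subspace_0[OF subspace_sym_matrices])

text \<open>Since \<open>W\<close> is symmetric, moving from \<open>x\<close> along
  \<open>w = W *v x\<close> changes the quadratic form at the rate
  \<open>2 * (w \<bullet> w)\<close>. The form is 0 at \<open>x\<close> and nowhere positive, so
  this rate cannot be positive.\<close>

lemma neg_semidef_kernel:
  assumes "neg_semidef W" and "x \<bullet> (W *v x) = 0"
  shows "W *v x = 0"
proof (rule ccontr)
  define w where "w = W *v x"
  define c where "c = w \<bullet> (W *v w)"
  \<comment> \<open>A step so short that the second-order term cannot cancel the first-order one:
    \<open>\<bar>\<tau> * c\<bar> \<le> w \<bullet> w\<close>. Adding 1 covers
    \<open>c = 0\<close>.\<close>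
  define \<tau> where "\<tau> = (w \<bullet> w) / (\<bar>c\<bar> + 1)"
  assume "W *v x \<noteq> 0"
  then have "0 < w \<bullet> w" by (simp add: w_def)
  then have "0 < \<tau>" by (simp add: \<tau>_def)
  have "x \<bullet> (W *v w) = w \<bullet> w"
    using assms(1) dot_lmul_matrix[of x W w]
    by (simp add: neg_semidef_def sym_matrices_def w_def flip: transpose_matrix_vector)
  then have "(x + \<tau> *\<^sub>R w) \<bullet> (W *v (x + \<tau> *\<^sub>R w)) = \<tau> * (2 * (w \<bullet> w) + \<tau> * c)"
    using assms(2) by (simp add: matrix_vector_right_distrib matrix_vector_mult_scaleR
        inner_add_left inner_add_right c_def algebra_simps flip: w_def)
  then have "\<tau> * (2 * (w \<bullet> w) + \<tau> * c) \<le> 0"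
    using assms(1) by (metis neg_semidef_def)
  then have "2 * (w \<bullet> w) + \<tau> * c \<le> 0"
    using \<open>0 < \<tau>\<close> by (simp add: mult_le_0_iff)
  moreover have "\<bar>\<tau> * c\<bar> \<le> w \<bullet> w"
    by (simp add: \<tau>_def abs_mult divide_simps mult_left_mono)
  ultimately show False using \<open>0 < w \<bullet> w\<close> by linarith
qed

lemma linear_meas: "linear (meas A)"
  by (rule linearI) (simp_all add: meas_def vec_eq_iff inner_add_left)

lemma inner_meas: "l \<bullet> meas A X = meas_adjoint A l \<bullet> X"
  by (subst inner_commute[of "meas_adjoint A l"])
    (simp add: inner_vec_def[of l] meas_def meas_adjoint_def inner_sum_right)

lemma meas_adjoint_scaleR: "meas_adjoint A (c *\<^sub>R l) = c *\<^sub>R meas_adjoint A l"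
  by (simp add: meas_adjoint_def scaleR_sum_right)

lemma meas_adjoint_in_sym_matrices:
  "(\<And>i. A i \<in> sym_matrices) \<Longrightarrow> meas_adjoint A l \<in> sym_matrices"
  unfolding meas_adjoint_def
  by (intro subspace_sum subspace_scale subspace_sym_matrices)

lemma meas_adjoint_mult_vec:
  fixes A :: "'m::finite \<Rightarrow> real^'n^'n"
  shows "meas_adjoint A l *v x = (\<Sum>i\<in>UNIV. l $ i *\<^sub>R (A i *v x))"
proof -
  have "linear (\<lambda>M :: real^'n^'n. M *v x)"
    by (rule linearI)
      (simp_all add: matrix_vector_mult_add_rdistrib scaleR_matrix_vector_assoc)
  from linear_sum[OF this, of "\<lambda>i. l $ i *\<^sub>R A i" UNIV] show ?thesis
    by (simp add: meas_adjoint_def scaleR_matrix_vector_assoc)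
qed

lemma independent_family_sum_zeroD:
  fixes v :: "'m::finite \<Rightarrow> 'a::real_vector"
  assumes "independent_family v" and "(\<Sum>i\<in>UNIV. c i *\<^sub>R v i) = 0"
  shows "c i = 0"
proof -
  have inj: "inj v" and ind: "independent (range v)"
    using assms(1) by (simp_all add: independent_family_def)
  \<comment> \<open>Dependence of a set takes coefficients indexed by its vectors, so
    \<open>c\<close> is carried over along \<open>inv v\<close>; injectivity keeps the summands
    apart.\<close>
  have "(\<Sum>y\<in>range v. c (inv v y) *\<^sub>R y) = 0"
    using assms(2) inj by (simp add: sum.reindex)
  then have "c (inv v (v i)) = 0"
    using ind by (auto simp: dependent_finite)
  then show ?thesis using inj by simp
qed

text \<open>The slack \<open>P\<close> turns the cone constraint on \<open>Y\<close> into the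
  equation \<open>Y - P = 0\<close>. Letting \<open>t\<close> range over a whole open ray, as in a
  strict epigraph, makes the set convex, and strictness keeps 0 out of it when \<open>X0\<close> is
  a minimizer.\<close>

definition strict_value_set ::
  "(real^'n^'n \<Rightarrow> real) \<Rightarrow> ('m::finite \<Rightarrow> real^'n^'n) \<Rightarrow> real^'n^'n
     \<Rightarrow> ((real^'m) \<times> (real^'n^'n) \<times> real) set" where
  "strict_value_set f A X0 =
     {(meas A (Y - X0), Y - P, t) | Y P t. Y \<in> sym_matrices \<and> pos_semidef P \<and> f Y - f X0 < t}"

lemma convex_strict_value_set:
  assumes "convex_on sym_matrices f"
  shows "convex (strict_value_set f A X0)"
proof (rule convexI)
  fix p q and u v :: real
  assume "p \<in> strict_value_set f A X0" "q \<in> strict_value_set f A X0"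
    and uv: "0 \<le> u" "0 \<le> v" "u + v = 1"
  then obtain Y P t Y' P' t'
    where p: "p = (meas A (Y - X0), Y - P, t)" "Y \<in> sym_matrices" "pos_semidef P" "f Y - f X0 < t"
      and q: "q = (meas A (Y' - X0), Y' - P', t')" "Y' \<in> sym_matrices" "pos_semidef P'"
        "f Y' - f X0 < t'"
    unfolding strict_value_set_def by blast
  let ?Y = "u *\<^sub>R Y + v *\<^sub>R Y'" and ?P = "u *\<^sub>R P + v *\<^sub>R P'" and ?t = "u * t + v * t'"
  have "?Y - X0 = u *\<^sub>R (Y - X0) + v *\<^sub>R (Y' - X0)"
    using uv(3) by (simp add: algebra_simps flip: scaleR_add_left)
  then have "meas A (?Y - X0) = u *\<^sub>R meas A (Y - X0) + v *\<^sub>R meas A (Y' - X0)"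
    by (simp add: linear_add[OF linear_meas] linear_scale[OF linear_meas])
  then have "u *\<^sub>R p + v *\<^sub>R q = (meas A (?Y - X0), ?Y - ?P, ?t)"
    by (simp add: p(1) q(1) algebra_simps)
  moreover have "?Y \<in> sym_matrices"
    using p(2) q(2) by (simp add: subspace_add subspace_scale subspace_sym_matrices)
  moreover have "pos_semidef ?P"
    using uv p(3) q(3) by (simp add: pos_semidef_add pos_semidef_scaleR)
  moreover have "f ?Y - f X0 < ?t"
  proof -
    have "f ?Y \<le> u * f Y + v * f Y'"
      using assms uv p(2) q(2) by (simp add: convex_on_def)
    \<comment> \<open>The bound stays strict even if \<open>u\<close> or \<open>v\<close> is 0,
      because they sum to 1.\<close>
    moreover have "u * (f Y - t) + v * (f Y' - t') < f X0"
      using p(4) q(4) uv by (intro convex_bound_lt) auto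
    ultimately show ?thesis by (simp add: algebra_simps)
  qed
  ultimately show "u *\<^sub>R p + v *\<^sub>R q \<in> strict_value_set f A X0"
    unfolding strict_value_set_def by blast
qed

text \<open>Separation alone allows \<open>s = 0\<close>; excluding that is left to the linear
  independence in the theorem. \<open>Y\<close> and \<open>P\<close> vary independently, so each
  property of the multipliers can be read off from a suitable pair.\<close>

lemma exists_fritz_john_multipliers:
  fixes f :: "real^'n^'n \<Rightarrow> real" and A :: "'m::finite \<Rightarrow> real^'n^'n"
  assumes "convex_on sym_matrices f"
    and min: "is_arg_min f (\<lambda>X. pos_semidef X \<and> meas A X = meas A X0) X0"
  obtains l :: "real^'m" and W and s :: real
  where "(l, W, s) \<noteq> 0" "W \<in> sym_matrices" "0 \<le> s"
    and "\<And>Y P. Y \<in> sym_matrices \<Longrightarrow> pos_semidef P \<Longrightarrow>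
      0 \<le> meas_adjoint A l \<bullet> (Y - X0) + W \<bullet> (Y - P) + s * (f Y - f X0)"
proof -
  let ?K = "strict_value_set f A X0"
  have X0: "pos_semidef X0" "X0 \<in> sym_matrices"
    using min by (auto simp: is_arg_min_def pos_semidef_def)
  have "0 \<notin> ?K"
  proof
    assume "0 \<in> ?K"
    \<comment> \<open>A zero middle component means \<open>Y = P\<close>, so \<open>Y\<close> would
      be feasible with a value below the minimum.\<close>
    then obtain Y where "pos_semidef Y" "meas A (Y - X0) = 0" "f Y - f X0 < 0"
      by (auto simp: strict_value_set_def zero_prod_def)
    then show False
      using min by (auto simp: is_arg_min_def linear_diff[OF linear_meas])
  qed
  \<comment> \<open>The separation theorem needs a nonempty set; any positive last entry would
    do.\<close>
  moreover have "(meas A (X0 - X0), X0 - X0, 1) \<in> ?K"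
    unfolding strict_value_set_def using X0 by force
  ultimately obtain a where "a \<in> span ?K" "a \<noteq> 0" and sep: "\<And>x. x \<in> ?K \<Longrightarrow> 0 \<le> a \<bullet> x"
    using separating_hyperplane_set_0_inspan[OF convex_strict_value_set[OF assms(1), of A X0]]
    by blast
  obtain l W s where a: "a = (l, W, s)" by (cases a) auto
  text \<open>Only membership in the span makes \<open>W\<close> symmetric: the value set says nothing about the
    component of a functional on the skew-symmetric matrices.\<close>
  have "span ?K \<subseteq> UNIV \<times> sym_matrices \<times> UNIV"
    by (rule span_minimal)
      (auto simp: strict_value_set_def pos_semidef_def subspace_diff subspace_sym_matrices
        intro!: subspace_Times)
  then have "W \<in> sym_matrices" using \<open>a \<in> span ?K\<close> a by auto
  have pair: "0 \<le> meas_adjoint A l \<bullet> (Y - X0) + W \<bullet> (Y - P) + s * t"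
    if "Y \<in> sym_matrices" "pos_semidef P" "f Y - f X0 < t" for Y P t
    using sep[of "(meas A (Y - X0), Y - P, t)"] that
    by (force simp: a strict_value_set_def inner_meas)
  have "0 \<le> s" using pair[of X0 X0 1] X0 by simp
  have "0 \<le> meas_adjoint A l \<bullet> (Y - X0) + W \<bullet> (Y - P) + s * (f Y - f X0)"
    if "Y \<in> sym_matrices" "pos_semidef P" for Y P
  proof (rule field_le_epsilon)
    fix e :: real assume "0 < e"
    \<comment> \<open>\<open>t\<close> must exceed \<open>f Y - f X0\<close>, so it is taken larger
      by \<open>e / (s + 1)\<close>, which costs at most \<open>e\<close> and is defined also for
      \<open>s = 0\<close>.\<close>
    then have "s * (e / (s + 1)) \<le> e"
      using \<open>0 \<le> s\<close> by (simp add: field_simps)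
    then show "0 \<le> meas_adjoint A l \<bullet> (Y - X0) + W \<bullet> (Y - P) + s * (f Y - f X0) + e"
      using pair[OF that, of "f Y - f X0 + e / (s + 1)"] \<open>0 < e\<close> \<open>0 \<le> s\<close>
      by (simp add: distrib_left)
  qed
  with that \<open>a \<noteq> 0\<close> a \<open>W \<in> sym_matrices\<close> \<open>0 \<le> s\<close> show thesis by blast
qed

theorem corollary1:
  fixes f :: "real^'n^'n \<Rightarrow> real"
    and A :: "'m::finite \<Rightarrow> real^'n^'n"
    and x0 :: "real^'n"
    and X0 :: "real^'n^'n"
    and b :: "real^'m"
  assumes "convex_on sym_matrices f"
    and "continuous_on sym_matrices f"
    and "\<And>i. A i \<in> sym_matrices"
    and "X0 = outer_square x0"
    and "b = meas A X0"
    and "is_arg_min f (\<lambda>X. pos_semidef X \<and> meas A X = b) X0"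
    and "independent_family (\<lambda>i. A i *v x0)"
  shows "\<exists>l Q. dual_certificate f A X0 l Q"
proof -
  obtain l :: "real^'m" and W s where nz: "(l, W, s) \<noteq> 0"
    and W: "W \<in> sym_matrices" and s: "0 \<le> s"
    and ineq: "\<And>Y P. Y \<in> sym_matrices \<Longrightarrow> pos_semidef P \<Longrightarrow>
      0 \<le> meas_adjoint A l \<bullet> (Y - X0) + W \<bullet> (Y - P) + s * (f Y - f X0)"
    using exists_fritz_john_multipliers[OF assms(1) assms(6)[unfolded assms(5)]] by blast
  have X0: "pos_semidef X0" "X0 \<in> sym_matrices"
    using pos_semidef_outer_square assms(4) by (auto simp: pos_semidef_def)
  \<comment> \<open>With \<open>Y = X0\<close> and \<open>P = X0 + outer_square v\<close>, only
    \<open>- (W \<bullet> outer_square v)\<close> survives.\<close>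
  have "v \<bullet> (W *v v) \<le> 0" for v
    using ineq[OF X0(2) pos_semidef_add[OF X0(1) pos_semidef_outer_square[of v]]]
    by (simp add: inner_outer_square)
  then have neg: "neg_semidef W" using W by (simp add: neg_semidef_def)
  have "0 \<le> W \<bullet> X0" using ineq[OF X0(2) pos_semidef_zero] by simp
  moreover have "W \<bullet> X0 \<le> 0"
    using neg by (simp add: assms(4) inner_outer_square neg_semidef_def)
  ultimately have WX0: "W \<bullet> X0 = 0" by simp
  have "s \<noteq> 0"
  proof
    assume "s = 0"
    let ?M = "meas_adjoint A l + W"
    have M: "?M \<in> sym_matrices"
      by (intro subspace_add subspace_sym_matrices meas_adjoint_in_sym_matrices assms(3) W)
    \<comment> \<open>\<open>Y\<close> need not be positive semidefinite, so it may move from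
      \<open>X0\<close> along \<open>- ?M\<close>; with \<open>P = X0\<close> the inequality reads
      \<open>0 \<le> - (?M \<bullet> ?M)\<close>.\<close>
    have "X0 - ?M \<in> sym_matrices"
      using X0(2) M by (simp add: subspace_diff subspace_sym_matrices)
    from ineq[OF this X0(1)] have "?M \<bullet> ?M \<le> 0"
      by (simp add: \<open>s = 0\<close> inner_diff_right inner_add_left inner_add_right)
    then have M0: "?M = 0"
      by (metis inner_eq_zero_iff inner_ge_zero order_antisym)
    have "W *v x0 = 0"
      using neg_semidef_kernel[OF neg] WX0 by (simp add: assms(4) inner_outer_square)
    moreover have "?M *v x0 = 0" unfolding M0 by simp
    ultimately have "(\<Sum>i\<in>UNIV. l $ i *\<^sub>R (A i *v x0)) = 0"
      by (simp add: matrix_vector_mult_add_rdistrib meas_adjoint_mult_vec)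
    then have "l = 0"
      using independent_family_sum_zeroD[OF assms(7)] by (simp add: vec_eq_iff)
    with M0 have "W = 0" by (simp add: meas_adjoint_def)
    with \<open>l = 0\<close> \<open>s = 0\<close> nz show False by (simp add: zero_prod_def)
  qed
  with s have "0 < s" by simp
  let ?l = "(1 / s) *\<^sub>R l" and ?Q = "(1 / s) *\<^sub>R W"
  let ?V = "meas_adjoint A ?l + ?Q"
  have Q: "?Q \<in> sym_matrices" using W by (simp add: subspace_scale subspace_sym_matrices)
  have "- ?V \<in> sym_matrices"
    by (intro subspace_neg subspace_add subspace_sym_matrices meas_adjoint_in_sym_matrices
        assms(3) Q)
  moreover have "f X0 + (- ?V) \<bullet> (Y - X0) \<le> f Y" if "Y \<in> sym_matrices" for Y
  proof -
    have "s * (?V \<bullet> (Y - X0)) = meas_adjoint A l \<bullet> (Y - X0) + W \<bullet> (Y - X0)"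
      using \<open>0 < s\<close> by (simp add: meas_adjoint_scaleR inner_add_left distrib_left)
    \<comment> \<open>Choosing \<open>P = X0\<close> merges both multipliers into one functional of
      \<open>Y - X0\<close>; dividing by \<open>s\<close> yields the subgradient inequality for
      \<open>- ?V\<close>.\<close>
    with ineq[OF that X0(1)] have "0 \<le> s * (?V \<bullet> (Y - X0) + (f Y - f X0))"
      by (simp add: distrib_left)
    with \<open>0 < s\<close> have "0 \<le> ?V \<bullet> (Y - X0) + (f Y - f X0)"
      by (simp add: zero_le_mult_iff)
    then show ?thesis by (simp only: inner_minus_left)
  qed
  ultimately have "- ?V \<in> subdifferential f X0" by (simp only: subdifferential_def) blast
  then have "?V \<in> uminus ` subdifferential f X0" by (rule rev_image_eqI) simp
  moreover have "neg_semidef ?Q"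
    using neg Q \<open>0 < s\<close>
    by (simp add: neg_semidef_def mult_le_0_iff divide_le_0_iff scaleR_matrix_vector_assoc[symmetric])
  moreover have "orthogonal ?Q X0" using WX0 by (simp add: orthogonal_def)
  ultimately show ?thesis using Q unfolding dual_certificate_def by blast
qed

end
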